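(* For every constant $c>2.774$ there exists an integer $\ell_c$ such that, with high probability (probability tending to $1$ as $n\to\infty$), the random graph $G_{n,c/n}$ has no graph homomorphism to the cycle $C_{2\ell+1}$ for any $\ell\geq \ell_c$.
   Context: $G_{n,p}$ is the Erdős–Rényi random graph on vertex set $\{1,\dots,n\}$ in which each pair of vertices is joined independently with probability $p$; here $p=c/n$. A homomorphism from $G$ to $H$ is a map $f:V(G)\to V(H)$ such that $xy\in E(G)$ implies $f(x)f(y)\in E(H)$. $C_{2\ell+1}$ denotes the cycle on $2\ell+1$ vertices. *)

theory Defs
  imports "HOL-Probability.Probability" "HOL-Probability.Product_PMF"
begin

type_synonym 'a ugraph = "'a set \<times> 'a set set"

definition all_edges :: "'a set \<Rightarrow> 'a set set" where
  "all_edges V = {e. e \<subseteq> V \<and> card e = 2}"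

definition simple_graph :: "'a ugraph \<Rightarrow> bool" where
  "simple_graph G \<longleftrightarrow> finite (fst G) \<and> snd G \<subseteq> all_edges (fst G)"

definition graph_hom :: "('a \<Rightarrow> 'b) \<Rightarrow> 'a ugraph \<Rightarrow> 'b ugraph \<Rightarrow> bool" where
  "graph_hom f G H \<longleftrightarrow>
     f \<in> fst G \<rightarrow> fst H \<and>
     (\<forall>x\<in>fst G. \<forall>y\<in>fst G. {x, y} \<in> snd G \<longrightarrow> {f x, f y} \<in> snd H)"

text \<open>The following is the usual cycle only for \<open>m \<ge> 3\<close>; for \<open>m = 1\<close> it degenerates to a loop.\<close>

definition cycle_graph :: "nat \<Rightarrow> nat ugraph" where
  "cycle_graph m = ({0..<m}, {{i, Suc i mod m} | i. i < m})"

text \<open>\<^const>\<open>bernoulli_pmf\<close> truncates its parameter to the unit interval, so for \<open>p > 1\<close>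
  (which for \<open>p = c / n\<close> affects only the finitely many \<open>n < c\<close>) the result is the complete
  graph.\<close>

definition random_graph :: "nat \<Rightarrow> real \<Rightarrow> nat ugraph pmf" where
  "random_graph n p =
     map_pmf (\<lambda>b. ({1..n}, {e \<in> all_edges {1..n}. b e}))
       (Pi_pmf (all_edges {1..n}) False (\<lambda>_. bernoulli_pmf p))"

lemma simple_graph_cycle_graph:
  assumes "m \<ge> 3"
  shows "simple_graph (cycle_graph m)"
proof -
  have "card {i, Suc i mod m} = 2" if "i < m" for i
  proof -
    have "Suc i mod m \<noteq> i"
      using assms that by (cases "Suc i = m") auto
    then show ?thesis by simp
  qed
  then show ?thesis
    using assms by (auto simp: simple_graph_def cycle_graph_def all_edges_def)
qed

lemma simple_graph_random_graph:
  assumes "G \<in> set_pmf (random_graph n p)"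
  shows "fst G = {1..n}" and "simple_graph G"
  using assms by (auto simp: random_graph_def simple_graph_def)

end

theory Submission
  imports Defs "HOL-Real_Asymp.Real_Asymp"
begin

text \<open>A homomorphism to an odd cycle splits the edges into as many classes as the cycle has
  edges, and cutting the cycle at the smallest class makes the graph bipartite. So a graph with a
  homomorphism to a long odd cycle has a vertex bipartition with a tiny fraction of monochromatic
  edges. For a fixed bipartition of \<open>{1..n}\<close> there are about \<open>n\<^sup>2/4\<close> or more monochromatic
  pairs, so this has probability about \<open>exp (- c n / 4)\<close> at most, and the union bound over
  the \<open>2 ^ n\<close> bipartitions succeeds as soon as \<open>c > 4 ln 2 = 2.7725...\<close>.\<close>

text \<open>For \<open>m = 2\<close> both indices would give the same edge; from
  \<open>m = 3\<close> on, edges are determined by their index, so their preimages under a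
  homomorphism are disjoint classes.\<close>

lemma cycle_graph_edge_eq_iff:
  assumes "m \<ge> 3" "i < m" "j < m"
  shows "{i, Suc i mod m} = {j, Suc j mod m} \<longleftrightarrow> i = j"
  using assms by (auto simp: doubleton_eq_iff mod_Suc split: if_splits)

lemma odd_cycle_hom_imp_near_bipartite:
  assumes G: "simple_graph G" and l: "l \<ge> 1"
    and hom: "graph_hom f G (cycle_graph (2 * l + 1))"
  obtains A where "A \<subseteq> fst G"
    "(2 * l + 1) * card {e \<in> snd G. e \<subseteq> A \<or> e \<inter> A = {}} \<le> card (snd G)"
proof -
  define m where "m = 2 * l + 1"
  define S where "S i = {e \<in> snd G. f ` e = {i, Suc i mod m}}" for i
  have m: "m \<ge> 3" using l by (simp add: m_def)
  have finG: "finite (snd G)"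
    using G by (auto simp: simple_graph_def all_edges_def intro: finite_subset[of _ "Pow (fst G)"])
  have "(\<Sum>i<m. card (S i)) = card (\<Union>i<m. S i)"
    using finG cycle_graph_edge_eq_iff[OF m]
    by (intro card_UN_disjoint[symmetric]) (auto simp: S_def)
  also have "\<dots> \<le> card (snd G)"
    using finG by (intro card_mono) (auto simp: S_def)
  finally have sum_le: "(\<Sum>i<m. card (S i)) \<le> card (snd G)" .
  \<comment> \<open>Pigeonhole: some class has at most the average size.\<close>
  obtain i where i: "i < m" "m * card (S i) \<le> card (snd G)"
  proof (rule ccontr)
    assume "\<not> thesis"
    with that have less: "\<And>i. i < m \<Longrightarrow> card (snd G) < m * card (S i)"
      by (meson not_le)
    have "(\<Sum>i<m. card (snd G)) < (\<Sum>i<m. m * card (S i))"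
      using m less by (intro sum_strict_mono) (auto simp: lessThan_empty_iff)
    also have "\<dots> = m * (\<Sum>i<m. card (S i))" by (simp add: sum_distrib_left)
    finally show False using sum_le by simp
  qed
  \<comment> \<open>Without edge \<open>i\<close> the cycle is the path
    \<open>i + 1, ..., m - 1, 0, ..., i\<close>. Its alternating 2-colouring is the parity of the
    label, flipped for labels beyond \<open>i\<close>.\<close>
  define A where "A = {x \<in> fst G. if f x \<le> i then even (f x) else odd (f x)}"
  have "{e \<in> snd G. e \<subseteq> A \<or> e \<inter> A = {}} \<subseteq> S i"
  proof (rule subsetI)
    fix e assume "e \<in> {e \<in> snd G. e \<subseteq> A \<or> e \<inter> A = {}}"
    then have e: "e \<in> snd G" and mono: "e \<subseteq> A \<or> e \<inter> A = {}" by auto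
    have "e \<subseteq> fst G" "card e = 2" using G e by (auto simp: simple_graph_def all_edges_def)
    then obtain x y where xy: "e = {x, y}" "x \<in> fst G" "y \<in> fst G"
      by (auto simp: card_2_iff)
    have "{f x, f y} \<in> snd (cycle_graph m)"
      using hom e xy by (auto simp: graph_hom_def m_def)
    then obtain j where j: "j < m" "{f x, f y} = {j, Suc j mod m}"
      by (auto simp: cycle_graph_def)
    have "j = i"
    proof (rule ccontr)
      assume "j \<noteq> i"
      have "(x \<in> A) \<noteq> (y \<in> A)"
      \<comment> \<open>Only the wrap-around edge needs \<open>m\<close> odd: its ends
        \<open>m - 1\<close> and 0 are both even, and the flip beyond \<open>i\<close> separates
        them. Every other edge besides \<open>i\<close> joins labels of opposite parity on the same
        side of the flip.\<close>
      proof (cases "Suc j = m")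
        case True
        then show ?thesis using j \<open>j \<noteq> i\<close> i xy
          by (auto simp: A_def m_def doubleton_eq_iff)
      next
        case False
        then show ?thesis using j \<open>j \<noteq> i\<close> i xy
          by (auto simp: A_def mod_Suc doubleton_eq_iff)
      qed
      with mono xy show False by auto
    qed
    then show "e \<in> S i" using j e xy by (simp add: S_def)
  qed
  then have "card {e \<in> snd G. e \<subseteq> A \<or> e \<inter> A = {}} \<le> card (S i)"
    using finG by (intro card_mono) (auto simp: S_def)
  then have "m * card {e \<in> snd G. e \<subseteq> A \<or> e \<inter> A = {}} \<le> card (snd G)"
    using i(2) by (meson le_trans mult_le_mono2)
  then show thesis
    by (intro that[of A]) (auto simp: A_def m_def)
qed

lemma finite_all_edges: "finite V \<Longrightarrow> finite (all_edges V)"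
  by (auto simp: all_edges_def intro: finite_subset[of _ "Pow V"])

text \<open>A crossing pair takes one point from \<open>A\<close> and one from its complement, and
  4ab \<le> (a + b)^2.\<close>

lemma card_crossing_pairs_le:
  assumes "finite V" "A \<subseteq> V"
  shows "4 * card {e \<in> all_edges V. \<not> (e \<subseteq> A \<or> e \<inter> A = {})} \<le> (card V)\<^sup>2"
proof -
  have "{e \<in> all_edges V. \<not> (e \<subseteq> A \<or> e \<inter> A = {})} \<subseteq> (\<lambda>(x, y). {x, y}) ` (A \<times> (V - A))"
    by (fastforce simp: all_edges_def card_2_iff image_iff)
  then have "card {e \<in> all_edges V. \<not> (e \<subseteq> A \<or> e \<inter> A = {})} \<le> card (A \<times> (V - A))"
    using assms by (meson finite_SigmaI finite_Diff finite_subset surj_card_le)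
  also have "\<dots> = card A * card (V - A)" by (rule card_cartesian_product)
  finally have "4 * card {e \<in> all_edges V. \<not> (e \<subseteq> A \<or> e \<inter> A = {})}
    \<le> 4 * (card A * card (V - A))" by simp
  also have "\<dots> \<le> (card A + card (V - A))\<^sup>2"
    using sum_squares_bound[of "real (card A)" "real (card (V - A))"]
    by (simp add: power2_sum flip: of_nat_le_iff[where 'a = real])
  also have "card A + card (V - A) = card V"
    using assms by (metis card_Diff_subset card_mono finite_subset le_add_diff_inverse)
  finally show ?thesis .
qed

text \<open>Markov's inequality applied to \<open>exp (s * (X - r * Y))\<close>, where \<open>X\<close> and \<open>Y\<close> count
  the successes outside and inside \<open>M\<close>.\<close>

lemma prob_bernoulli_ratio_le:
  fixes p r s :: real
  assumes E: "finite E" "M \<subseteq> E" and p: "0 \<le> p" "p \<le> 1" and s: "s \<ge> 0"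
  shows "measure_pmf.prob (Pi_pmf E False (\<lambda>_. bernoulli_pmf p))
      {b. r * card {e \<in> M. b e} \<le> card {e \<in> E - M. b e}}
    \<le> exp (p * ((exp s - 1) * card (E - M) - (1 - exp (- r * s)) * card M))"
    (is "measure_pmf.prob ?P ?B \<le> _")
proof -
  \<comment> \<open>The exponent is a sum of one weight per present edge, so \<open>h\<close> is a
    product over edges and its expectation factorises by independence.\<close>
  define w where "w e = (if e \<in> M then - r * s else s)" for e
  define h where "h b = (\<Prod>e\<in>E. if b e then exp (w e) else 1)" for b
  have h_eq: "h b = exp (s * (card {e \<in> E - M. b e} - r * card {e \<in> M. b e}))" for b
  proof -
    have "h b = (\<Prod>e\<in>E - M. if b e then exp (w e) else 1) * (\<Prod>e\<in>M. if b e then exp (w e) else 1)"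
      unfolding h_def by (rule prod.subset_diff[OF E(2,1)])
    also have "\<dots> = (\<Prod>e\<in>E - M. if b e then exp s else 1) * (\<Prod>e\<in>M. if b e then exp (- r * s) else 1)"
      by (intro arg_cong2[where f = "(*)"] prod.cong) (auto simp: w_def)
    also have "\<dots> = exp s ^ card {e \<in> E - M. b e} * exp (- r * s) ^ card {e \<in> M. b e}"
      using E finite_subset[OF E(2,1)]
      by (simp add: prod.inter_filter[symmetric])
    finally show ?thesis
      by (simp add: exp_of_nat_mult[symmetric] exp_add[symmetric] algebra_simps)
  qed
  have fin: "finite (set_pmf ?P)"
    using E by (intro finite_subset[OF set_Pi_pmf_subset']) (auto intro!: finite_PiE_dflt)
  have "measure_pmf.prob ?P ?B = measure_pmf.expectation ?P (indicator ?B)" by simp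
  also have "\<dots> \<le> measure_pmf.expectation ?P h"
  proof (intro integral_mono integrable_measure_pmf_finite fin)
    fix b show "indicator ?B b \<le> h b"
      using s by (auto simp: h_eq indicator_def)
  qed
  also have "\<dots> = (\<Prod>e\<in>E. measure_pmf.expectation (bernoulli_pmf p) (\<lambda>v. if v then exp (w e) else 1))"
    unfolding h_def using E by (intro expectation_prod_Pi_pmf integrable_measure_pmf_finite) auto
  also have "\<dots> = (\<Prod>e\<in>E. 1 + p * (exp (w e) - 1))"
    using p by (simp add: algebra_simps)
  \<comment> \<open>Apply 1 + x \<le> exp x to each factor, which is nonnegative as 1 - p plus a
    nonnegative term.\<close>
  also have "\<dots> \<le> (\<Prod>e\<in>E. exp (p * (exp (w e) - 1)))"
  proof (intro prod_mono conjI exp_ge_add_one_self)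
    fix e show "0 \<le> 1 + p * (exp (w e) - 1)"
      using p add_nonneg_nonneg[of "1 - p" "p * exp (w e)"] by (simp add: algebra_simps)
  qed
  also have "\<dots> = exp (p * (\<Sum>e\<in>E. exp (w e) - 1))"
    using E by (simp add: exp_sum sum_distrib_left)
  also have "(\<Sum>e\<in>E. exp (w e) - 1) = (exp s - 1) * card (E - M) - (1 - exp (- r * s)) * card M"
  proof -
    have "(\<Sum>e\<in>E. exp (w e) - 1) = (\<Sum>e\<in>E - M. exp s - 1) + (\<Sum>e\<in>M. exp (- r * s) - 1)"
      using E by (subst sum.subset_diff[of M])
        (simp_all add: w_def)
    then show ?thesis by (simp add: algebra_simps)
  qed
  finally show ?thesis .
qed

text \<open>The preceding tail bound with \<open>r = 2 * k\<close>. The hypothesis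
  \<open>c \<le> n\<close> makes \<open>c / n\<close> a probability, and a balanced \<open>A\<close>
  is essentially the worst case.\<close>

lemma prob_near_bipartition_le:
  fixes c s :: real and n k :: nat
  assumes n: "n \<ge> 1" "c \<le> n" and c: "c \<ge> 0" and s: "s \<ge> 0" and A: "A \<subseteq> {1..n}"
  shows "measure_pmf.prob (random_graph n (c / n))
      {G. 2 * k * card {e \<in> snd G. e \<subseteq> A \<or> e \<inter> A = {}}
        \<le> card {e \<in> snd G. \<not> (e \<subseteq> A \<or> e \<inter> A = {})}}
    \<le> exp (c / 2 + c / 4 * (exp s + exp (- 2 * real k * s) - 2) * n)"
proof -
  define E where "E = all_edges {1..n}"
  define M where "M = {e \<in> E. e \<subseteq> A \<or> e \<inter> A = {}}"
  define u where "u = exp s - 1"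
  define v where "v = 1 - exp (- 2 * real k * s)"
  have fin: "finite E" by (simp add: E_def finite_all_edges)
  have ME: "M \<subseteq> E" by (auto simp: M_def)
  have EM: "E - M = {e \<in> E. \<not> (e \<subseteq> A \<or> e \<inter> A = {})}" by (auto simp: M_def)
  have uv: "u \<ge> 0" "v \<ge> 0" "v \<le> 1" using s by (auto simp: u_def v_def)
  have "4 * card (E - M) \<le> n\<^sup>2"
    using card_crossing_pairs_le[of "{1..n}" A] A by (subst EM) (simp add: E_def)
  then have X: "real (card (E - M)) \<le> n\<^sup>2 / 4"
    by (simp add: field_simps flip: of_nat_le_iff[where 'a = real])
  have "real (card M) + card (E - M) = card E"
    using fin ME by (metis card_Diff_subset card_mono finite_subset le_add_diff_inverse of_nat_add)
  also have "\<dots> = n * (real n - 1) / 2"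
    using n_subsets[of "{1..n}" 2] n(1)
    by (simp add: E_def all_edges_def choose_two real_of_nat_div of_nat_diff)
  \<comment> \<open>All n(n - 1)/2 pairs minus at most n^2/4 crossing ones. The deficit n/2 costs
    only the factor \<open>exp (c / 2)\<close> in the end, because \<open>v \<le> 1\<close>.\<close>
  finally have Y: "real (card M) \<ge> n\<^sup>2 / 4 - n / 2"
    using X by (simp add: field_simps power2_eq_square)
  have "measure_pmf.prob (random_graph n (c / n))
      {G. 2 * k * card {e \<in> snd G. e \<subseteq> A \<or> e \<inter> A = {}}
        \<le> card {e \<in> snd G. \<not> (e \<subseteq> A \<or> e \<inter> A = {})}}
    = measure_pmf.prob (Pi_pmf E False (\<lambda>_. bernoulli_pmf (c / n)))
      {b. real (2 * k) * card {e \<in> M. b e} \<le> card {e \<in> E - M. b e}}"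
  proof -
    have "{e \<in> {e \<in> E. b e}. e \<subseteq> A \<or> e \<inter> A = {}} = {e \<in> M. b e}"
      "{e \<in> {e \<in> E. b e}. \<not> (e \<subseteq> A \<or> e \<inter> A = {})} = {e \<in> E - M. b e}" for b
      by (auto simp: M_def)
    then show ?thesis
      unfolding random_graph_def measure_map_pmf E_def[symmetric] vimage_Collect_eq snd_conv
      by (simp only: of_nat_mult[symmetric] of_nat_le_iff)
  qed
  also have "\<dots> \<le> exp (c / n * (u * card (E - M) - v * card M))"
    using prob_bernoulli_ratio_le[OF fin ME, of "c / n" s "real (2 * k)"] n c s
    by (simp add: u_def v_def)
  also have "\<dots> \<le> exp (c / n * (u * (n\<^sup>2 / 4) - v * (n\<^sup>2 / 4 - n / 2)))"
    using X Y uv c n by (intro exp_le_cancel_iff[THEN iffD2] mult_left_mono diff_mono) auto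
  also have "c / n * (u * (n\<^sup>2 / 4) - v * (n\<^sup>2 / 4 - n / 2)) = c / 4 * (u - v) * n + c / 2 * v"
    using n by (simp add: field_simps power2_eq_square)
  also have "\<dots> \<le> c / 2 + c / 4 * (exp s + exp (- 2 * real k * s) - 2) * n"
    using uv c mult_left_mono[of v 1 "c / 2"] by (simp add: u_def v_def algebra_simps)
  finally show ?thesis by simp
qed

text \<open>One union bound over bipartitions serves all \<open>l \<ge> k\<close> at once, since a
  larger \<open>l\<close> forces an even smaller share of monochromatic edges. The
  \<open>2 ^ n\<close> choices of \<open>A\<close> contribute the summand
  \<open>ln 2\<close>.\<close>

lemma prob_odd_cycle_hom_le:
  fixes c s :: real and n k :: nat
  assumes n: "n \<ge> 1" "c \<le> n" and c: "c \<ge> 0" and s: "s \<ge> 0" and k: "k \<ge> 1"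
  shows "measure_pmf.prob (random_graph n (c / n))
      {G. \<exists>l\<ge>k. \<exists>f. graph_hom f G (cycle_graph (2 * l + 1))}
    \<le> exp (c / 2) * exp (ln 2 + c / 4 * (exp s + exp (- 2 * real k * s) - 2)) ^ n"
    (is "measure_pmf.prob ?P ?B \<le> _")
proof -
  define C :: "nat set \<Rightarrow> nat ugraph set" where "C A = {G. 2 * k * card {e \<in> snd G. e \<subseteq> A \<or> e \<inter> A = {}}
        \<le> card {e \<in> snd G. \<not> (e \<subseteq> A \<or> e \<inter> A = {})}}" for A
  define x where "x = c / 4 * (exp s + exp (- 2 * real k * s) - 2)"
  \<comment> \<open>Restricting to the support guarantees a simple graph on
    \<open>{1..n}\<close>.\<close>
  have "?B \<inter> set_pmf ?P \<subseteq> (\<Union>A\<in>Pow {1..n}. C A)"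
  proof safe
    fix G l f
    assume G: "G \<in> set_pmf ?P" and l: "l \<ge> k" "graph_hom f G (cycle_graph (2 * l + 1))"
    have sG: "simple_graph G" "fst G = {1..n}"
      using simple_graph_random_graph[OF G] by auto
    obtain A where A: "A \<subseteq> fst G"
      "(2 * l + 1) * card {e \<in> snd G. e \<subseteq> A \<or> e \<inter> A = {}} \<le> card (snd G)"
      using odd_cycle_hom_imp_near_bipartite[OF sG(1) _ l(2)] k l(1) by auto
    have "finite (snd G)"
      using sG by (auto simp: simple_graph_def intro: finite_subset finite_all_edges)
    then have "card (snd G) = card {e \<in> snd G. e \<subseteq> A \<or> e \<inter> A = {}}
      + card {e \<in> snd G. \<not> (e \<subseteq> A \<or> e \<inter> A = {})}"
      by (subst card_Un_disjoint[symmetric]) (auto intro: arg_cong[where f = card])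
    \<comment> \<open>Subtracting the monochromatic edges from both sides turns the factor
      \<open>2 * l + 1\<close> into \<open>2 * l\<close>.\<close>
    with A have "2 * l * card {e \<in> snd G. e \<subseteq> A \<or> e \<inter> A = {}}
      \<le> card {e \<in> snd G. \<not> (e \<subseteq> A \<or> e \<inter> A = {})}"
      by simp
    moreover have "2 * k * card {e \<in> snd G. e \<subseteq> A \<or> e \<inter> A = {}}
      \<le> 2 * l * card {e \<in> snd G. e \<subseteq> A \<or> e \<inter> A = {}}"
      using l by (intro mult_le_mono) auto
    ultimately have "G \<in> C A" unfolding C_def mem_Collect_eq by linarith
    then show "G \<in> (\<Union>A\<in>Pow {1..n}. C A)" using A sG by auto
  qed
  then have "measure_pmf.prob ?P ?B \<le> measure_pmf.prob ?P (\<Union>A\<in>Pow {1..n}. C A)"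
    by (subst measure_Int_set_pmf[symmetric]) (intro measure_pmf.finite_measure_mono, auto)
  also have "\<dots> \<le> (\<Sum>A\<in>Pow {1..n}. measure_pmf.prob ?P (C A))"
    by (intro measure_pmf.finite_measure_subadditive_finite) auto
  also have "\<dots> \<le> (\<Sum>A\<in>Pow {1..n}. exp (c / 2 + x * n))"
    unfolding C_def x_def using assms by (intro sum_mono prob_near_bipartition_le) auto
  also have "\<dots> = exp (c / 2) * exp (ln 2 + x) ^ n"
    by (simp add: card_Pow exp_add power_mult_distrib exp_of_nat2_mult algebra_simps)
  finally show ?thesis by (simp add: x_def)
qed

theorem theorem3:
  fixes c :: real
  assumes "c > 2.774"
  shows "\<exists>l\<^sub>c::nat. l\<^sub>c \<ge> 1 \<and>
    (\<lambda>n. measure_pmf.prob (random_graph n (c / real n))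
       {G. \<forall>l\<ge>l\<^sub>c. \<not> (\<exists>f. graph_hom f G (cycle_graph (2 * l + 1)))}) \<longlonglongrightarrow> 1"
proof -
  \<comment> \<open>This is where 2.774 enters: it slightly exceeds 4 ln 2.\<close>
  have ln2: "ln 2 < c / 4"
    using assms ln_approx_bounds[of 2 2] by (simp add: eval_nat_numeral)
  \<comment> \<open>The parameter s = 1 / sqrt k tends to 0 while k * s tends to infinity, so the
    first exponential tends to 1 and the second to 0. The rate then tends to ln 2 - c/4 < 0, and a
    fixed large \<open>k\<close> gives geometric decay in \<open>n\<close>.\<close>
  have "(\<lambda>k::nat. exp (1 / sqrt k) + exp (- 2 * real k * (1 / sqrt k)) - 2) \<longlonglongrightarrow> - 1"
    by real_asymp
  then have "(\<lambda>k::nat. ln 2 + c / 4 * (exp (1 / sqrt k) + exp (- 2 * real k * (1 / sqrt k)) - 2))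
    \<longlonglongrightarrow> ln 2 + c / 4 * (- 1)"
    by (intro tendsto_add tendsto_mult tendsto_const)
  then have ev: "eventually (\<lambda>k::nat. ln 2 + c / 4 * (exp (1 / sqrt k) + exp (- 2 * real k * (1 / sqrt k)) - 2) < 0) sequentially"
    by (rule order_tendstoD(2)) (use ln2 in simp)
  obtain k :: nat where k: "k \<ge> 1"
    "ln 2 + c / 4 * (exp (1 / sqrt k) + exp (- 2 * real k * (1 / sqrt k)) - 2) < 0"
    using eventually_happens[OF eventually_conj[OF eventually_ge_at_top[of 1] ev]] by auto
  define q where "q = exp (ln 2 + c / 4 * (exp (1 / sqrt k) + exp (- 2 * real k * (1 / sqrt k)) - 2))"
  have q: "0 \<le> q" "q < 1" using k by (simp_all add: q_def)
  let ?good = "\<lambda>n. measure_pmf.prob (random_graph n (c / real n))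
       {G. \<forall>l\<ge>k. \<not> (\<exists>f. graph_hom f G (cycle_graph (2 * l + 1)))}"
  have "eventually (\<lambda>n. 1 - exp (c / 2) * q ^ n \<le> ?good n) sequentially"
    using eventually_ge_at_top[of "max 1 (nat \<lceil>c\<rceil>)"]
  proof eventually_elim
    case (elim n)
    then have n: "n \<ge> 1" "c \<le> n" by linarith+
    let ?B = "{G. \<exists>l\<ge>k. \<exists>f. graph_hom f G (cycle_graph (2 * l + 1))}"
    have "?good n = measure_pmf.prob (random_graph n (c / n)) (- ?B)"
      by (intro arg_cong[where f = "measure_pmf.prob _"]) auto
    also have "\<dots> = 1 - measure_pmf.prob (random_graph n (c / n)) ?B"
      using measure_pmf.prob_compl[of ?B "random_graph n (c / n)"] by (simp add: Compl_eq_Diff_UNIV)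
    moreover have "measure_pmf.prob (random_graph n (c / n)) ?B \<le> exp (c / 2) * q ^ n"
      unfolding q_def using assms by (intro prob_odd_cycle_hom_le n k(1)) auto
    ultimately show ?case by linarith
  qed
  moreover have "(\<lambda>n. 1 - exp (c / 2) * q ^ n) \<longlonglongrightarrow> 1 - exp (c / 2) * 0"
    using q by (intro tendsto_diff tendsto_mult tendsto_const LIMSEQ_power_zero) simp
  ultimately have "?good \<longlonglongrightarrow> 1"
    using tendsto_sandwich[where h = "\<lambda>_. 1" and g = ?good] by simp
  with k show ?thesis by blast
qed

end
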